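(* Let $(x^k)_{k\in\mathbb N}$ be a sequence generated by algorithm FBTN (described in the context) applied to the minimization of $\varphi=f+g$ over $\mathbb R^n$. Then every accumulation point of $(x^k)_{k\in\mathbb N}$ is optimal, i.e. belongs to $\operatorname{argmin}\varphi$.
   Context: Setting: $f:\mathbb R^n\to\mathbb R$ is convex, twice continuously differentiable, with $L_f$-Lipschitz continuous gradient ($L_f>0$); $g:\mathbb R^n\to\mathbb R\cup\{\infty\}$ is proper, convex and lower semicontinuous; $\varphi=f+g$, $\varphi_\star=\inf\varphi$, $\mathcal X_\star=\operatorname{argmin}\varphi$. It is assumed that $\mathcal X_\star\neq\emptyset$. Notation, for $\gamma>0$: $\operatorname{prox}_{\gamma g}(x)=\operatorname{argmin}_w\{g(w)+\frac1{2\gamma}\|w-x\|^2\}$; $T_\gamma(x)=\operatorname{prox}_{\gamma g}(x-\gamma\nabla f(x))$; $R_\gamma(x)=\frac1\gamma(x-T_\gamma(x))$; $Q_\gamma(x)=I-\gamma\nabla^2 f(x)$. The forward-backward envelope is $\varphi_\gamma(x)=\min_{w\in\mathbb R^n}\{f(x)+\langle\nabla f(x),w-x\rangle+\frac1{2\gamma}\|w-x\|^2+g(w)\}=f(x)-\frac\gamma2\|\nabla f(x)\|^2+g^\gamma(x-\gamma\nabla f(x))$, where $g^\gamma(x)=\min_w\{g(w)+\frac1{2\gamma}\|w-x\|^2\}$; it is continuously differentiable with $\nabla\varphi_\gamma(x)=Q_\gamma(x)R_\gamma(x)$. For a locally Lipschitz map $G$, $\partial_CG(x)$ is the Clarke generalized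 Jacobian: the convex hull of all limits of Jacobians $JG(x^j)$ along sequences $x^j\to x$ of points of differentiability of $G$. The approximate generalized Hessian is $\hat\partial^2\varphi_\gamma(x)=\{\gamma^{-1}Q_\gamma(x)(I-PQ_\gamma(x)) : P\in\partial_C(\operatorname{prox}_{\gamma g})(x-\gamma\nabla f(x))\}$ (nonempty, consisting of symmetric positive semidefinite matrices when $\gamma\le 1/L_f$). Algorithm FBTN. Parameters: $\gamma\in(0,1/L_f)$, $\sigma\in(0,\frac{\gamma(1-\gamma L_f)}2)$, $\bar\eta,\zeta\in(0,1)$, $\rho,\nu\in(0,1]$, initial point $x^0\in\mathbb R^n$. For $k=0,1,2,\dots$: (1) set $\delta_k=\zeta\|\nabla\varphi_\gamma(x^k)\|^\nu$, $\eta_k=\min\{\bar\eta,\|\nabla\varphi_\gamma(x^k)\|^\rho\}$, $\varepsilon_k=\eta_k\|\nabla\varphi_\gamma(x^k)\|$; (2) for some $H_k\in\hat\partial^2\varphi_\gamma(x^k)$, find (by the conjugate gradient method) an $\varepsilon_k$-approximate solution $d^k$ of the linear system $(H_k+\delta_kI)d=-\nabla\varphi_\gamma(x^k)$, i.e. $\|(H_k+\delta_kI)d^k+\nabla\varphi_\gamma(x^k)\|\le\varepsilon_k$; (3) let $\tau_k$ be the maximum in $\{2^{-i}: i=0,1,2,\dots\}$ such that $\varphi_\gamma(x^{k+1})\le\varphi_\gamma(x^k)-\sigma\|R_\gamma(x^k)\|^2$, where $x^{k+1}=(1-\tau_k)T_\gamma(x^k)+\tau_k(x^k+d^k)$. The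 algorithm is run with infinite accuracy, and it is assumed that $R_\gamma(x^k)\ne0$ for all $k$, so that an infinite sequence is generated. *)

theory Defs
  imports "HOL-Analysis.Analysis"
begin

definition gradient :: "(real^'n \<Rightarrow> real) \<Rightarrow> real^'n \<Rightarrow> real^'n" where
  "gradient f x = (THE D. GDERIV f x :> D)"

definition hessian :: "(real^'n \<Rightarrow> real) \<Rightarrow> real^'n \<Rightarrow> real^'n^'n" where
  "hessian f x = jacobian (gradient f) (at x)"

definition twice_continuously_differentiable :: "(real^'n \<Rightarrow> real) \<Rightarrow> bool" where
  "twice_continuously_differentiable f \<longleftrightarrow>
     (\<forall>x. f differentiable (at x)) \<and>
     (\<forall>x. gradient f differentiable (at x)) \<and>
     continuous_on UNIV (hessian f)"

definition clarke_jacobian :: "(real^'n \<Rightarrow> real^'m) \<Rightarrow> real^'n \<Rightarrow> (real^'n^'m) set" where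
  "clarke_jacobian G x = convex hull
     {J. \<exists>X. (\<forall>j. G differentiable (at (X j))) \<and> X \<longlonglongrightarrow> x \<and>
             (\<lambda>j. jacobian G (at (X j))) \<longlonglongrightarrow> J}"

definition proper :: "('a \<Rightarrow> ereal) \<Rightarrow> bool" where
  "proper g \<longleftrightarrow> (\<forall>x. g x \<noteq> -\<infinity>) \<and> (\<exists>x. g x \<noteq> \<infinity>)"

text \<open>On \<^typ>\<open>ereal\<close> we have \<open>0 * \<infinity> = 0\<close>, so the weights \<open>0\<close> and \<open>1\<close> are harmless.
  The inequality is meant for functions that do not take the value \<open>-\<infinity>\<close>, since \<^typ>\<open>ereal\<close>
  sets \<open>\<infinity> + (-\<infinity>) = \<infinity>\<close>.\<close>

definition ereal_convex :: "('a::real_vector \<Rightarrow> ereal) \<Rightarrow> bool" where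
  "ereal_convex g \<longleftrightarrow>
     (\<forall>x y. \<forall>u\<ge>0. \<forall>v\<ge>0. u + v = 1 \<longrightarrow>
        g (u *\<^sub>R x + v *\<^sub>R y) \<le> ereal u * g x + ereal v * g y)"

definition lower_semicontinuous :: "('a::topological_space \<Rightarrow> ereal) \<Rightarrow> bool" where
  "lower_semicontinuous g \<longleftrightarrow> (\<forall>x. g x \<le> Liminf (at x) g)"

definition argmin :: "('a \<Rightarrow> ereal) \<Rightarrow> 'a set" where
  "argmin h = {x. is_arg_min h (\<lambda>_. True) x}"

text \<open>For proper, convex, lower semicontinuous \<open>g\<close> and \<open>\<gamma> > 0\<close> the minimizer is unique,
  so the choice made by \<^const>\<open>arg_min\<close> is immaterial.\<close>

definition prox :: "real \<Rightarrow> (real^'n \<Rightarrow> ereal) \<Rightarrow> real^'n \<Rightarrow> real^'n" where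
  "prox \<gamma> g x = arg_min (\<lambda>w. g w + ereal (1 / (2 * \<gamma>) * (norm (w - x))\<^sup>2)) (\<lambda>_. True)"

definition fb_step :: "(real^'n \<Rightarrow> real) \<Rightarrow> (real^'n \<Rightarrow> ereal) \<Rightarrow> real \<Rightarrow> real^'n \<Rightarrow> real^'n" where
  "fb_step f g \<gamma> x = prox \<gamma> g (x - \<gamma> *\<^sub>R gradient f x)"

definition fb_residual :: "(real^'n \<Rightarrow> real) \<Rightarrow> (real^'n \<Rightarrow> ereal) \<Rightarrow> real \<Rightarrow> real^'n \<Rightarrow> real^'n" where
  "fb_residual f g \<gamma> x = (1 / \<gamma>) *\<^sub>R (x - fb_step f g \<gamma> x)"

definition Qmat :: "(real^'n \<Rightarrow> real) \<Rightarrow> real \<Rightarrow> real^'n \<Rightarrow> real^'n^'n" where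
  "Qmat f \<gamma> x = mat 1 - \<gamma> *\<^sub>R hessian f x"

text \<open>Forward-backward envelope. Under the standing assumptions the infimum is attained and
  finite, so \<^const>\<open>real_of_ereal\<close> loses nothing; it is needed to speak of the gradient.\<close>

definition fbe :: "(real^'n \<Rightarrow> real) \<Rightarrow> (real^'n \<Rightarrow> ereal) \<Rightarrow> real \<Rightarrow> real^'n \<Rightarrow> real" where
  "fbe f g \<gamma> x = real_of_ereal
     (INF w. ereal (f x + gradient f x \<bullet> (w - x) + 1 / (2 * \<gamma>) * (norm (w - x))\<^sup>2) + g w)"

definition approx_gen_hessian ::
    "(real^'n \<Rightarrow> real) \<Rightarrow> (real^'n \<Rightarrow> ereal) \<Rightarrow> real \<Rightarrow> real^'n \<Rightarrow> (real^'n^'n) set" where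
  "approx_gen_hessian f g \<gamma> x =
     {(1 / \<gamma>) *\<^sub>R (Qmat f \<gamma> x ** (mat 1 - P ** Qmat f \<gamma> x)) | P.
        P \<in> clarke_jacobian (prox \<gamma> g) (x - \<gamma> *\<^sub>R gradient f x)}"

text \<open>One iteration from \<open>x\<close> to \<open>x'\<close>, as a relation: the choice of \<open>H\<close> and the inexact
  solution \<open>d\<close> are nondeterministic. Any \<open>d\<close> meeting the residual tolerance is admitted, in
  particular the one returned by the conjugate gradient method.\<close>

definition fbtn_step ::
    "(real^'n \<Rightarrow> real) \<Rightarrow> (real^'n \<Rightarrow> ereal) \<Rightarrow>
     real \<Rightarrow> real \<Rightarrow> real \<Rightarrow> real \<Rightarrow> real \<Rightarrow> real \<Rightarrow> real^'n \<Rightarrow> real^'n \<Rightarrow> bool" where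
  "fbtn_step f g \<gamma> \<sigma> \<eta>bar \<zeta> \<rho> \<nu> x x' \<longleftrightarrow>
     (let G = gradient (fbe f g \<gamma>) x;
          \<delta> = \<zeta> * norm G powr \<nu>;
          \<eta> = min \<eta>bar (norm G powr \<rho>);
          \<epsilon> = \<eta> * norm G
      in \<exists>H d \<tau>.
           H \<in> approx_gen_hessian f g \<gamma> x \<and>
           norm ((H + \<delta> *\<^sub>R mat 1) *v d + G) \<le> \<epsilon> \<and>
           (let next_pt = (\<lambda>t. (1 - t) *\<^sub>R fb_step f g \<gamma> x + t *\<^sub>R (x + d))
            in is_arg_max (\<lambda>t. t)
                 (\<lambda>t. t \<in> range (\<lambda>i::nat. (1 / 2) ^ i) \<and>
                      fbe f g \<gamma> (next_pt t) \<le> fbe f g \<gamma> x - \<sigma> * (norm (fb_residual f g \<gamma> x))\<^sup>2)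
                 \<tau> \<and>
               x' = next_pt \<tau>))"

definition fbtn_sequence ::
    "(real^'n \<Rightarrow> real) \<Rightarrow> (real^'n \<Rightarrow> ereal) \<Rightarrow>
     real \<Rightarrow> real \<Rightarrow> real \<Rightarrow> real \<Rightarrow> real \<Rightarrow> real \<Rightarrow> (nat \<Rightarrow> real^'n) \<Rightarrow> bool" where
  "fbtn_sequence f g \<gamma> \<sigma> \<eta>bar \<zeta> \<rho> \<nu> x \<longleftrightarrow>
     (\<forall>k. fbtn_step f g \<gamma> \<sigma> \<eta>bar \<zeta> \<rho> \<nu> (x k) (x (Suc k)))"

end

theory Submission
  imports Defs
begin

text \<open>The linesearch condition alone forces convergence: the envelope is bounded below by the
  optimal value and decreases by at least \<open>\<sigma> \<parallel>R\<^sub>\<gamma>(x\<^sup>k)\<parallel>\<^sup>2\<close> in each iteration, so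
  \<open>R\<^sub>\<gamma>(x\<^sup>k) \<rightarrow> 0\<close>, whatever the directions. Hence along a subsequence with limit \<open>z\<close> the
  forward-backward points also tend to \<open>z\<close>; passing to the limit in their minimality, by lower
  semicontinuity of \<open>g\<close>, shows that \<open>z\<close> minimizes its own forward-backward model. Comparing
  \<open>z\<close> with \<open>z + t(u - z)\<close> for small \<open>t\<close> then gives optimality for \<open>f + g\<close>.\<close>

section \<open>Gradients: descent lemma and tangent inequality\<close>

lemma GDERIV_gradient:
  fixes f :: "real^'n \<Rightarrow> real"
  assumes "f differentiable (at x)"
  shows "GDERIV f x :> gradient f x"
proof -
  obtain f' where f': "(f has_derivative f') (at x)"
    using assms by (auto simp: differentiable_def)
  have lin: "linear f'" using f' by (rule has_derivative_linear)
  \<comment> \<open>Riesz representation: the functional \<open>f'\<close> is the inner product with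
    \<open>adjoint f' 1\<close>, which supplies the witness for the \<open>THE\<close> in
    \<open>gradient\<close>.\<close>
  have "f' = (\<lambda>h. h \<bullet> adjoint f' 1)"
    using adjoint_works[OF lin, of _ 1] by auto
  then have D: "GDERIV f x :> adjoint f' 1"
    using f' by (simp add: gderiv_def)
  have "E = adjoint f' 1" if "GDERIV f x :> E" for E
  proof -
    have "(\<lambda>h. h \<bullet> E) = (\<lambda>h. h \<bullet> adjoint f' 1)"
      using D that unfolding gderiv_def by (rule has_derivative_unique[symmetric])
    then show ?thesis by (metis vector_eq_ldot)
  qed
  with D show ?thesis unfolding gradient_def by (rule theI)
qed

lemma DERIV_along_line:
  fixes f :: "real^'n \<Rightarrow> real"
  assumes "\<And>y. f differentiable (at y)"
  shows "((\<lambda>t. f (x + t *\<^sub>R d)) has_real_derivative gradient f (x + t *\<^sub>R d) \<bullet> d) (at t)"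
proof -
  have "(f has_derivative (\<lambda>h. h \<bullet> gradient f (x + t *\<^sub>R d))) (at (x + t *\<^sub>R d))"
    using GDERIV_gradient[OF assms] by (simp add: gderiv_def)
  moreover have "((\<lambda>t. x + t *\<^sub>R d) has_derivative (\<lambda>h. h *\<^sub>R d)) (at t)"
    by (auto intro!: derivative_eq_intros)
  ultimately have "((\<lambda>t. f (x + t *\<^sub>R d)) has_derivative
      (\<lambda>h. (h *\<^sub>R d) \<bullet> gradient f (x + t *\<^sub>R d))) (at t)"
    using has_derivative_compose by blast
  then show ?thesis
    by (simp add: has_field_derivative_def inner_commute mult_commute_abs)
qed

lemma descent_lemma:
  fixes f :: "real^'n \<Rightarrow> real"
  assumes diff: "\<And>y. f differentiable (at y)"
    and lip: "L-lipschitz_on UNIV (gradient f)"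
  shows "f w \<le> f x + gradient f x \<bullet> (w - x) + L / 2 * (norm (w - x))\<^sup>2"
proof -
  define d where "d = w - x"
  \<comment> \<open>\<open>\<psi>\<close> is the gap between \<open>f\<close> on the segment and its
    quadratic model. By Cauchy-Schwarz and the Lipschitz bound its derivative is nonpositive, and
    \<open>\<psi> 1 \<le> \<psi> 0\<close> is the claim.\<close>
  define \<psi> where "\<psi> t = f (x + t *\<^sub>R d) - t * (gradient f x \<bullet> d) - L / 2 * t\<^sup>2 * (norm d)\<^sup>2" for t
  have "\<exists>y. (\<psi> has_real_derivative y) (at t) \<and> y \<le> 0" if "0 \<le> t" for t
  proof -
    let ?y = "gradient f (x + t *\<^sub>R d) \<bullet> d - gradient f x \<bullet> d - L * t * (norm d)\<^sup>2"
    have "(\<psi> has_real_derivative ?y) (at t)"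
      unfolding \<psi>_def
      by (auto intro!: derivative_eq_intros DERIV_along_line[OF diff])
    moreover have "gradient f (x + t *\<^sub>R d) \<bullet> d - gradient f x \<bullet> d
        \<le> norm (gradient f (x + t *\<^sub>R d) - gradient f x) * norm d"
      unfolding inner_diff_left[symmetric] by (rule norm_cauchy_schwarz)
    moreover have "norm (gradient f (x + t *\<^sub>R d) - gradient f x) * norm d
        \<le> (L * (t * norm d)) * norm d"
      using lipschitz_onD[OF lip, of "x + t *\<^sub>R d" x] that
      by (intro mult_right_mono) (auto simp: dist_norm)
    moreover have "(L * (t * norm d)) * norm d = L * t * (norm d)\<^sup>2"
      by (simp add: power2_eq_square)
    ultimately show ?thesis by (intro exI[of _ ?y]) linarith
  qed
  then have "\<psi> 1 \<le> \<psi> 0"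
    by (intro DERIV_nonpos_imp_nonincreasing[of 0 1 \<psi>]) auto
  then show ?thesis by (simp add: \<psi>_def d_def)
qed

text \<open>Restriction to the line through \<open>x\<close> and \<open>u\<close> reduces this to
  the tangent inequality for convex functions of one real variable.\<close>

lemma convex_above_gradient:
  fixes f :: "real^'n \<Rightarrow> real"
  assumes cvx: "convex_on UNIV f" and diff: "\<And>y. f differentiable (at y)"
  shows "f x + gradient f x \<bullet> (u - x) \<le> f u"
proof -
  have "convex_on UNIV (\<lambda>t. f (x + t *\<^sub>R (u - x)))"
  proof (rule convex_onI)
    fix t a b :: real
    assume t: "0 < t" "t < 1"
    have "x + ((1 - t) *\<^sub>R a + t *\<^sub>R b) *\<^sub>R (u - x)
        = (1 - t) *\<^sub>R (x + a *\<^sub>R (u - x)) + t *\<^sub>R (x + b *\<^sub>R (u - x))"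
      by (simp add: algebra_simps)
    then show "f (x + ((1 - t) *\<^sub>R a + t *\<^sub>R b) *\<^sub>R (u - x))
        \<le> (1 - t) * f (x + a *\<^sub>R (u - x)) + t * f (x + b *\<^sub>R (u - x))"
      using convex_onD[OF cvx, of t] t by simp
  qed auto
  from convex_on_imp_above_tangent[OF this, of 0 1 "gradient f x \<bullet> (u - x)"]
  show ?thesis
    using DERIV_along_line[OF diff, of x "u - x" 0] by auto
qed

section \<open>Lower semicontinuity and existence of minimizers\<close>

text \<open>The bounds may vary with \<open>n\<close>, so that continuous terms of an objective can
  be moved to the right-hand side before passing to the limit. This serves both for minimizing
  sequences and for the forward-backward points.\<close>

lemma lower_semicontinuous_sequentially_le:
  fixes g :: "'a::topological_space \<Rightarrow> ereal"
  assumes lsc: "lower_semicontinuous g"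
    and w: "w \<longlonglongrightarrow> z" and c: "c \<longlonglongrightarrow> c0"
    and le: "\<And>n. g (w n) \<le> ereal (c n)"
  shows "g z \<le> ereal c0"
proof (rule ccontr)
  assume "\<not> g z \<le> ereal c0"
  then obtain a where a: "ereal c0 < ereal a" "ereal a < g z"
    using ereal_dense2[of "ereal c0" "g z"] by (auto simp: not_le)
  have "eventually (\<lambda>y. ereal a < g y) (at z)"
    using lsc a(2) le_Liminf_iff[of "g z" "at z" g] unfolding lower_semicontinuous_def by blast
  \<comment> \<open>The \<open>Liminf\<close> ignores the point \<open>z\<close>, which the sequence
    \<open>w\<close> may visit; there the bound is the choice of \<open>a\<close>.\<close>
  then have "eventually (\<lambda>y. ereal a < g y) (nhds z)"
    using a(2) by (simp add: eventually_nhds_conv_at)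
  then have "eventually (\<lambda>n. ereal a < g (w n)) sequentially"
    using w by (rule eventually_compose_filterlim)
  moreover have "eventually (\<lambda>n. c n < a) sequentially"
    using c a(1) by (auto intro: order_tendstoD)
  ultimately have "eventually (\<lambda>n. False) sequentially"
    by eventually_elim (use le in \<open>metis less_ereal.simps(1) less_le_trans order_less_asym\<close>)
  then show False by simp
qed

text \<open>Direct method: quadratic growth bounds a minimizing sequence, compactness gives a limit
  point, and lower semicontinuity shows that the infimum is attained there.\<close>

lemma lower_semicontinuous_coercive_attains_min:
  fixes g :: "'a::euclidean_space \<Rightarrow> ereal" and q :: "'a \<Rightarrow> real"
  assumes lsc: "lower_semicontinuous g" and proper: "proper g"
    and q: "continuous_on UNIV q" and c: "0 < c"
    and coercive: "\<And>w. ereal (m + c * (norm (w - x))\<^sup>2) \<le> g w + ereal (q w)"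
  shows "\<exists>w. \<forall>u. g w + ereal (q w) \<le> g u + ereal (q u)"
proof -
  define h where "h w = g w + ereal (q w)" for w
  obtain y0 where y0: "g y0 \<noteq> \<infinity>" using proper by (auto simp: proper_def)
  have "ereal m \<le> h w" for w
    using coercive[of w] c order_trans[of "ereal m" "ereal (m + c * (norm (w - x))\<^sup>2)"]
    by (simp add: h_def)
  then have "ereal m \<le> (INF w. h w)" by (intro INF_greatest)
  moreover have "(INF w. h w) \<le> h y0" by (rule INF_lower) simp
  moreover have "h y0 < \<infinity>" using y0 by (simp add: h_def)
  ultimately obtain I where I: "(INF w. h w) = ereal I"
    by (cases "INF w. h w") auto
  have "\<exists>w. h w < ereal (I + 1 / real (Suc n))" for n
  proof -
    have "(INF w. h w) < ereal (I + 1 / real (Suc n))" by (simp add: I)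
    then show ?thesis by (auto simp: INF_less_iff)
  qed
  then obtain w where w: "\<And>n. h (w n) < ereal (I + 1 / real (Suc n))" by metis
  \<comment> \<open>All values along \<open>w\<close> stay below \<open>I + 1\<close>, because
    \<open>1 / real (Suc n) \<le> 1\<close>; coercivity turns this into a radius independent of
    \<open>n\<close>.\<close>
  have bd: "norm (w n - x) \<le> sqrt ((I + 1 - m) / c)" for n
  proof -
    have "ereal (m + c * (norm (w n - x))\<^sup>2) < ereal (I + 1 / real (Suc n))"
      using coercive[of "w n"] w[of n] unfolding h_def by (rule le_less_trans)
    moreover have "1 / real (Suc n) \<le> 1" by simp
    ultimately have "m + c * (norm (w n - x))\<^sup>2 \<le> I + 1"
      unfolding less_ereal.simps by linarith
    then have "(norm (w n - x))\<^sup>2 \<le> (I + 1 - m) / c"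
      using c by (simp add: field_simps)
    then show ?thesis by (rule real_le_rsqrt)
  qed
  then have "\<forall>n. w n \<in> cball x (sqrt ((I + 1 - m) / c))"
    by (simp add: dist_norm norm_minus_commute)
  then obtain l s where s: "strict_mono s" "(w \<circ> s) \<longlonglongrightarrow> l"
    using compact_imp_seq_compact[OF compact_cball] unfolding seq_compact_def by metis
  have "(\<lambda>n. q (w (s n))) \<longlonglongrightarrow> q l"
    using continuous_on_tendsto_compose[OF q, of "w \<circ> s" l sequentially] s(2) by simp
  moreover have "(\<lambda>n. 1 / real (Suc (s n))) \<longlonglongrightarrow> 0"
    using LIMSEQ_subseq_LIMSEQ[OF LIMSEQ_inverse_real_of_nat s(1)]
    by (simp add: o_def inverse_eq_divide)
  ultimately have lim: "(\<lambda>n. I + 1 / real (Suc (s n)) - q (w (s n))) \<longlonglongrightarrow> I + 0 - q l"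
    by (intro tendsto_intros)
  have "g ((w \<circ> s) n) \<le> ereal (I + 1 / real (Suc (s n)) - q (w (s n)))" for n
    using w[of "s n"] by (cases "g (w (s n))") (auto simp: h_def)
  then have "g l \<le> ereal (I + 0 - q l)"
    by (rule lower_semicontinuous_sequentially_le[OF lsc s(2) lim])
  then have "h l \<le> ereal I" by (cases "g l") (auto simp: h_def)
  then have "h l \<le> h u" for u
    using INF_lower[of u UNIV h] I by auto
  then show ?thesis unfolding h_def by blast
qed

section \<open>The forward-backward model and its minimizer\<close>

text \<open>The real-valued part of the objective in \<open>fbe\<close>, kept apart from
  \<open>g\<close> so that it can be handled by real arithmetic and continuity.\<close>

definition fb_quadratic :: "(real^'n \<Rightarrow> real) \<Rightarrow> real \<Rightarrow> real^'n \<Rightarrow> real^'n \<Rightarrow> real" where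
  "fb_quadratic f \<gamma> x w = f x + gradient f x \<bullet> (w - x) + 1 / (2 * \<gamma>) * (norm (w - x))\<^sup>2"

text \<open>The second summand does not depend on \<open>w\<close>, so the model and the objective
  of \<open>prox\<close> at the gradient step have the same minimizers.\<close>

lemma fb_quadratic_complete_square:
  assumes "\<gamma> \<noteq> 0"
  shows "fb_quadratic f \<gamma> x w = 1 / (2 * \<gamma>) * (norm (w - (x - \<gamma> *\<^sub>R gradient f x)))\<^sup>2
    + (f x - \<gamma> / 2 * (norm (gradient f x))\<^sup>2)"
proof -
  have "w - (x - \<gamma> *\<^sub>R gradient f x) = (w - x) + \<gamma> *\<^sub>R gradient f x" by simp
  then have "(norm (w - (x - \<gamma> *\<^sub>R gradient f x)))\<^sup>2 =
      (norm (w - x))\<^sup>2 + 2 * \<gamma> * (gradient f x \<bullet> (w - x)) + \<gamma>\<^sup>2 * (norm (gradient f x))\<^sup>2"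
    by (simp only: power2_norm_eq_inner)
      (simp add: inner_add_left inner_add_right inner_commute power2_eq_square)
  then show ?thesis
    using assms by (simp add: fb_quadratic_def field_simps power2_eq_square)
qed

text \<open>By the descent lemma the model exceeds \<open>f + g\<close> by a multiple of the squared
  distance. This yields both coercivity of the model and the lower bound on the envelope.\<close>

lemma fb_quadratic_lower_bound:
  fixes f :: "real^'n \<Rightarrow> real" and g :: "real^'n \<Rightarrow> ereal"
  assumes diff: "\<And>y. f differentiable (at y)"
    and lip: "L-lipschitz_on UNIV (gradient f)"
    and min: "\<And>y. ereal p \<le> ereal (f y) + g y"
  shows "ereal (p + (1 / \<gamma> - L) / 2 * (norm (w - x))\<^sup>2) \<le> g w + ereal (fb_quadratic f \<gamma> x w)"
proof -
  have "f w + (1 / \<gamma> - L) / 2 * (norm (w - x))\<^sup>2 \<le> fb_quadratic f \<gamma> x w"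
    using descent_lemma[OF diff lip, of w x]
    by (simp add: fb_quadratic_def left_diff_distrib diff_divide_distrib)
  then show ?thesis
    using min[of w] by (cases "g w") auto
qed

text \<open>\<open>prox\<close> selects by \<open>arg_min\<close>, which is meaningful only once a
  minimizer exists. Existence comes from the direct method, where \<open>L < 1 / \<gamma>\<close>
  makes the growth constant positive.\<close>

lemma fb_step_minimizes:
  fixes f :: "real^'n \<Rightarrow> real" and g :: "real^'n \<Rightarrow> ereal"
  assumes diff: "\<And>y. f differentiable (at y)"
    and lip: "L-lipschitz_on UNIV (gradient f)"
    and proper: "proper g" and lsc: "lower_semicontinuous g"
    and min: "\<And>y. ereal p \<le> ereal (f y) + g y"
    and gamma: "0 < \<gamma>" "L < 1 / \<gamma>"
  shows "g (fb_step f g \<gamma> x) + ereal (fb_quadratic f \<gamma> x (fb_step f g \<gamma> x))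
    \<le> g u + ereal (fb_quadratic f \<gamma> x u)"
proof -
  define y where "y = x - \<gamma> *\<^sub>R gradient f x"
  define h where "h w = g w + ereal (1 / (2 * \<gamma>) * (norm (w - y))\<^sup>2)" for w
  define C where "C = f x - \<gamma> / 2 * (norm (gradient f x))\<^sup>2"
  have eq: "g w + ereal (fb_quadratic f \<gamma> x w) = h w + ereal C" for w
    using fb_quadratic_complete_square[of \<gamma> f x w] gamma(1)
    by (cases "g w") (auto simp: h_def y_def C_def)
  have cont: "continuous_on UNIV (fb_quadratic f \<gamma> x)"
    unfolding fb_quadratic_def by (intro continuous_intros)
  have "\<exists>w. \<forall>u. g w + ereal (fb_quadratic f \<gamma> x w) \<le> g u + ereal (fb_quadratic f \<gamma> x u)"
    using gamma
    by (intro lower_semicontinuous_coercive_attains_min[OF lsc proper cont,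
          of "(1 / \<gamma> - L) / 2" p x] fb_quadratic_lower_bound[OF diff lip min]) simp
  then obtain w where "\<And>u. h w \<le> h u"
    by (auto simp: eq ereal_add_le_add_iff2)
  then have "is_arg_min h (\<lambda>_. True) w"
    by (auto simp: is_arg_min_def not_less)
  moreover have "fb_step f g \<gamma> x = arg_min h (\<lambda>_. True)"
    by (simp add: fb_step_def prox_def h_def[abs_def] y_def)
  ultimately have "is_arg_min h (\<lambda>_. True) (fb_step f g \<gamma> x)"
    unfolding arg_min_def by (metis someI)
  then have "h (fb_step f g \<gamma> x) \<le> h u" by (auto simp: is_arg_min_def not_less)
  then show ?thesis unfolding eq by (rule add_right_mono)
qed

lemma fbe_lower_bound:
  fixes f :: "real^'n \<Rightarrow> real" and g :: "real^'n \<Rightarrow> ereal"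
  assumes diff: "\<And>y. f differentiable (at y)"
    and lip: "L-lipschitz_on UNIV (gradient f)"
    and proper: "proper g"
    and min: "\<And>y. ereal p \<le> ereal (f y) + g y"
    and gamma: "L \<le> 1 / \<gamma>"
  shows "p \<le> fbe f g \<gamma> x"
proof -
  define M where "M w = ereal (fb_quadratic f \<gamma> x w) + g w" for w
  have "ereal p \<le> M w" for w
  proof -
    have "p \<le> p + (1 / \<gamma> - L) / 2 * (norm (w - x))\<^sup>2" using gamma by simp
    then show ?thesis
      using fb_quadratic_lower_bound[OF diff lip min, of \<gamma> w x]
      unfolding M_def by (metis add.commute ereal_less_eq(3) order_trans)
  qed
  then have "ereal p \<le> (INF w. M w)" by (intro INF_greatest)
  \<comment> \<open>Finiteness from above matters: \<open>real_of_ereal\<close> sends an infinite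
    infimum to 0, which need not lie above \<open>p\<close>.\<close>
  moreover obtain y0 where "g y0 \<noteq> \<infinity>" using proper by (auto simp: proper_def)
  then have "M y0 < \<infinity>" by (simp add: M_def)
  then have "(INF w. M w) < \<infinity>" by (meson INF_lower UNIV_I le_less_trans)
  moreover have "fbe f g \<gamma> x = real_of_ereal (INF w. M w)"
    by (simp add: fbe_def M_def fb_quadratic_def)
  ultimately show ?thesis by (cases "INF w. M w") auto
qed

section \<open>Vanishing decrease and optimality of model minimizers\<close>

text \<open>\<open>V\<close> is decreasing and bounded below, hence convergent; its consecutive
  differences tend to 0 and dominate \<open>a\<close>.\<close>

lemma tendsto_zero_of_sufficient_decrease:
  fixes V a :: "nat \<Rightarrow> real"
  assumes dec: "\<And>k. V (Suc k) \<le> V k - a k"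
    and nonneg: "\<And>k. 0 \<le> a k" and bound: "\<And>k. p \<le> V k"
  shows "a \<longlonglongrightarrow> 0"
proof -
  have "decseq V"
  proof (rule decseq_SucI)
    show "V (Suc k) \<le> V k" for k using dec[of k] nonneg[of k] by simp
  qed
  then obtain v where "V \<longlonglongrightarrow> v"
    using decseq_convergent bound by blast
  then have "(\<lambda>k. V k - V (Suc k)) \<longlonglongrightarrow> v - v"
    by (intro tendsto_diff LIMSEQ_Suc)
  then have lim: "(\<lambda>k. V k - V (Suc k)) \<longlonglongrightarrow> 0" by simp
  have "norm (a k) \<le> V k - V (Suc k)" for k
    using dec[of k] nonneg[of k] by simp
  then show ?thesis
    by (intro Lim_null_comparison[OF always_eventually lim] allI)
qed

text \<open>On the segment from \<open>z\<close> to \<open>u\<close> the proximal term is of order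
  \<open>t\<^sup>2\<close>, while convexity of \<open>g\<close> bounds its change linearly in
  \<open>t\<close>. Dividing by \<open>t\<close> and letting it tend to 0 removes the proximal term,
  and the tangent inequality replaces the linearization by \<open>f u\<close>.\<close>

lemma fb_model_minimizer_optimal:
  fixes f :: "real^'n \<Rightarrow> real" and g :: "real^'n \<Rightarrow> ereal"
  assumes cvx: "convex_on UNIV f" and diff: "\<And>y. f differentiable (at y)"
    and proper: "proper g" and g_cvx: "ereal_convex g"
    and min: "\<And>w. ereal (f z) + g z \<le> g w + ereal (fb_quadratic f \<gamma> z w)"
  shows "ereal (f z) + g z \<le> ereal (f u) + g u"
proof (cases "g u")
  case (real b)
  obtain a where a: "g z = ereal a"
    using min[of u] proper real by (cases "g z") (auto simp: proper_def)
  define D where "D = gradient f z \<bullet> (u - z)"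
  define N where "N = 1 / (2 * \<gamma>) * (norm (u - z))\<^sup>2"
  have le: "a - b - D \<le> t * N" if t: "0 < t" "t < 1" for t
  proof -
    let ?w = "(1 - t) *\<^sub>R z + t *\<^sub>R u"
    have "g ?w \<le> ereal (1 - t) * g z + ereal t * g u"
      using g_cvx t unfolding ereal_convex_def by simp
    then have gw: "g ?w \<le> ereal ((1 - t) * a + t * b)" by (simp add: a real)
    have wz: "?w - z = t *\<^sub>R (u - z)" by (simp add: algebra_simps)
    have "fb_quadratic f \<gamma> z ?w = f z + t * D + t\<^sup>2 * N"
      unfolding fb_quadratic_def wz D_def N_def by (simp add: power_mult_distrib)
    with min[of ?w] have "ereal (f z + a) \<le> g ?w + ereal (f z + t * D + t\<^sup>2 * N)"
      by (simp add: a)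
    also have "\<dots> \<le> ereal ((1 - t) * a + t * b) + ereal (f z + t * D + t\<^sup>2 * N)"
      using gw by (rule add_right_mono)
    finally have "t * (a - b - D) \<le> t * (t * N)"
      by (simp add: algebra_simps power2_eq_square)
    then show ?thesis using t by simp
  qed
  have "a - b - D \<le> 0"
  proof (rule tendsto_lowerbound)
    have "((\<lambda>t. t * N) \<longlongrightarrow> 0 * N) (at_right 0)" by (intro tendsto_intros)
    then show "((\<lambda>t. t * N) \<longlongrightarrow> 0) (at_right 0)" by simp
    show "eventually (\<lambda>t. a - b - D \<le> t * N) (at_right 0)"
      using eventually_at_right_less[of 0] eventually_at_right_real[of 0 1]
      by (auto elim!: eventually_mono intro!: le)
  qed simp
  moreover have "f z + D \<le> f u"
    using convex_above_gradient[OF cvx diff] by (simp add: D_def)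
  ultimately show ?thesis by (simp add: a real)
qed (use proper in \<open>auto simp: proper_def\<close>)

section \<open>Limit passage along the iterates\<close>

theorem theorem5p2:
  fixes f :: "real^'n \<Rightarrow> real" and g :: "real^'n \<Rightarrow> ereal"
    and L \<gamma> \<sigma> \<eta>bar \<zeta> \<rho> \<nu> :: real
    and x :: "nat \<Rightarrow> real^'n" and z :: "real^'n" and r :: "nat \<Rightarrow> nat"
  assumes f_convex: "convex_on UNIV f"
    and f_C2: "twice_continuously_differentiable f"
    and L_pos: "L > 0"
    and f_lipschitz: "L-lipschitz_on UNIV (gradient f)"
    and g_proper: "proper g"
    and g_convex: "ereal_convex g"
    and g_lsc: "lower_semicontinuous g"
    and solvable: "argmin (\<lambda>y. ereal (f y) + g y) \<noteq> {}"
    and gamma: "0 < \<gamma>" "\<gamma> < 1 / L"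
    and sigma: "0 < \<sigma>" "\<sigma> < \<gamma> * (1 - \<gamma> * L) / 2"
    and eta_bar: "0 < \<eta>bar" "\<eta>bar < 1"
    and zeta: "0 < \<zeta>" "\<zeta> < 1"
    and rho: "0 < \<rho>" "\<rho> \<le> 1"
    and nu: "0 < \<nu>" "\<nu> \<le> 1"
    and generated: "fbtn_sequence f g \<gamma> \<sigma> \<eta>bar \<zeta> \<rho> \<nu> x"
    and no_termination: "\<forall>k. fb_residual f g \<gamma> (x k) \<noteq> 0"
    and accumulation: "strict_mono r" "(x \<circ> r) \<longlonglongrightarrow> z"
  shows "z \<in> argmin (\<lambda>y. ereal (f y) + g y)"
proof -
  have diff: "\<And>y. f differentiable (at y)"
    using f_C2 by (simp add: twice_continuously_differentiable_def)
  have gam: "L < 1 / \<gamma>"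
    using gamma L_pos by (simp add: field_simps)
  obtain xs where xs: "\<And>y. ereal (f xs) + g xs \<le> ereal (f y) + g y"
    using solvable by (auto simp: argmin_def is_arg_min_def not_less)
  \<comment> \<open>Properness makes the optimal value a real number \<open>p\<close>: the finite
    value at \<open>y0\<close> rules out infinity at the minimizer \<open>xs\<close>.\<close>
  obtain y0 where "g y0 \<noteq> \<infinity>" using g_proper by (auto simp: proper_def)
  then have "g xs \<noteq> \<infinity>" using xs[of y0] by (cases "g y0") auto
  moreover have "g xs \<noteq> -\<infinity>" using g_proper by (simp add: proper_def)
  ultimately obtain p where "ereal (f xs) + g xs = ereal p" by (cases "g xs") auto
  with xs have p: "\<And>y. ereal p \<le> ereal (f y) + g y" by metis

  \<comment> \<open>The accepted step size \<open>\<tau>\<close> satisfies the constraint of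
    \<open>is_arg_max\<close>, which contains exactly this decrease.\<close>
  have "fbe f g \<gamma> (x (Suc k)) \<le> fbe f g \<gamma> (x k) - \<sigma> * (norm (fb_residual f g \<gamma> (x k)))\<^sup>2" for k
    using generated unfolding fbtn_sequence_def fbtn_step_def Let_def is_arg_max_def by metis
  then have "(\<lambda>k. \<sigma> * (norm (fb_residual f g \<gamma> (x k)))\<^sup>2) \<longlonglongrightarrow> 0"
    using sigma gam
    by (intro tendsto_zero_of_sufficient_decrease[where V = "\<lambda>k. fbe f g \<gamma> (x k)" and p = p]
        fbe_lower_bound[OF diff f_lipschitz g_proper p]) auto
  then have "(\<lambda>k. inverse \<sigma> * (\<sigma> * (norm (fb_residual f g \<gamma> (x k)))\<^sup>2)) \<longlonglongrightarrow> 0"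
    by (rule tendsto_mult_right_zero)
  then have "(\<lambda>k. (norm (fb_residual f g \<gamma> (x k)))\<^sup>2) \<longlonglongrightarrow> 0"
    using sigma by (simp add: mult.assoc[symmetric])
  then have "(\<lambda>k. fb_residual f g \<gamma> (x k)) \<longlonglongrightarrow> 0"
    using tendsto_norm_zero_cancel by fastforce
  then have R: "(\<lambda>k. fb_residual f g \<gamma> (x (r k))) \<longlonglongrightarrow> 0"
    using LIMSEQ_subseq_LIMSEQ[OF _ accumulation(1)] by (fastforce simp: o_def)

  have xr: "(\<lambda>k. x (r k)) \<longlonglongrightarrow> z" using accumulation(2) by (simp add: o_def)
  have "fb_step f g \<gamma> y = y - \<gamma> *\<^sub>R fb_residual f g \<gamma> y" for y
    using gamma(1) by (simp add: fb_residual_def)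
  moreover have "(\<lambda>k. x (r k) - \<gamma> *\<^sub>R fb_residual f g \<gamma> (x (r k))) \<longlonglongrightarrow> z - \<gamma> *\<^sub>R 0"
    by (intro tendsto_intros xr R)
  ultimately have T: "(\<lambda>k. fb_step f g \<gamma> (x (r k))) \<longlonglongrightarrow> z" by simp
  have f_lim: "(\<lambda>k. f (x (r k))) \<longlonglongrightarrow> f z"
    using isCont_tendsto_compose[OF differentiable_imp_continuous_within[OF diff] xr] .
  have grad_lim: "(\<lambda>k. gradient f (x (r k))) \<longlonglongrightarrow> gradient f z"
    using continuous_on_tendsto_compose[OF lipschitz_on_continuous_on[OF f_lipschitz] xr] by simp

  \<comment> \<open>Minimality of the forward-backward point against a fixed \<open>w\<close> with
    finite \<open>g w\<close> bounds its \<open>g\<close>-value by a convergent real sequence. In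
    the limit both arguments of the subtracted model become \<open>z\<close>, where it equals
    \<open>f z\<close>.\<close>
  have min: "ereal (f z) + g z \<le> g w + ereal (fb_quadratic f \<gamma> z w)" for w
  proof (cases "g w")
    case (real b)
    let ?T = "\<lambda>k. fb_step f g \<gamma> (x (r k))"
    have "(\<lambda>k. b + fb_quadratic f \<gamma> (x (r k)) w - fb_quadratic f \<gamma> (x (r k)) (?T k))
        \<longlonglongrightarrow> b + fb_quadratic f \<gamma> z w - fb_quadratic f \<gamma> z z"
      unfolding fb_quadratic_def by (intro tendsto_intros xr f_lim grad_lim T)
    moreover have "g (?T k)
        \<le> ereal (b + fb_quadratic f \<gamma> (x (r k)) w - fb_quadratic f \<gamma> (x (r k)) (?T k))" for k
      using fb_step_minimizes[OF diff f_lipschitz g_proper g_lsc p gamma(1) gam, of "x (r k)" w] real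
      by (cases "g (?T k)") auto
    ultimately have "g z \<le> ereal (b + fb_quadratic f \<gamma> z w - fb_quadratic f \<gamma> z z)"
      by (rule lower_semicontinuous_sequentially_le[OF g_lsc T])
    then show ?thesis
      by (cases "g z") (auto simp: real fb_quadratic_def)
  qed (use g_proper in \<open>auto simp: proper_def\<close>)
  have "ereal (f z) + g z \<le> ereal (f u) + g u" for u
    by (rule fb_model_minimizer_optimal[OF f_convex diff g_proper g_convex min])
  then show ?thesis
    by (auto simp: argmin_def is_arg_min_def not_less)
qed

end
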